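(* There exists a constant $C$ independent of $h$ and $z$ such that for all $0<h<1$ and all $z\in\Omega_h$, $$G_h^z(z)\le C h^{-1}.$$
   Context: Let $\Omega\subset\mathbb{R}^3$ be a convex bounded domain with sufficiently smooth boundary. Let $\{\mathcal{T}_h\}_{0<h<1}$ be a quasi-uniform, shape-regular family of triangulations (by tetrahedra) of size $h$ of polyhedral computational domains $\Omega_h\subset\Omega$. Let $V_h(\Omega_h)$ be the space of continuous functions on $\Omega_h$ that are affine on each tetrahedron of $\mathcal{T}_h$, and let $V_h^0(\Omega_h)\subset V_h(\Omega_h)$ be the subspace of functions vanishing on $\partial\Omega_h$ (extended by zero to $\Omega$ where needed). Write $(u,v)_\Omega=\int_\Omega u\cdot v\,dx$. The discrete Green's function with singularity at $z\in\Omega_h$ is the unique $G_h^z\in V_h^0(\Omega_h)$ satisfying $(\nabla G_h^z,\nabla v_h)_\Omega=v_h(z)$ for all $v_h\in V_h^0(\Omega_h)$. *)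

theory Defs
  imports "HOL-Analysis.Analysis"
begin

type_synonym R3 = "real ^ 3"

definition is_domain :: "R3 set \<Rightarrow> bool" where
  "is_domain D \<longleftrightarrow> open D \<and> connected D \<and> D \<noteq> {}"

(* Classical gradient; unspecified where u is not differentiable.  A continuous piecewise affine
   function is differentiable off the (null) set of faces of the mesh, and there this agrees with
   its weak gradient. *)
definition grad :: "(R3 \<Rightarrow> real) \<Rightarrow> R3 \<Rightarrow> R3" where
  "grad u x = (\<chi> i. frechet_derivative u (at x) (axis i 1))"

(* Only used on open U. *)
fun Ck_on :: "nat \<Rightarrow> R3 set \<Rightarrow> (R3 \<Rightarrow> real) \<Rightarrow> bool" where
  "Ck_on 0 U f \<longleftrightarrow> continuous_on U f"
| "Ck_on (Suc k) U f \<longleftrightarrow> f differentiable_on U \<and> (\<forall>i. Ck_on k U (\<lambda>x. grad f x $ i))"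

(* The boundary is locally the zero set of a regular C^k defining function, with D on one side
   (k \<ge> 1). *)
definition Ck_boundary :: "nat \<Rightarrow> R3 set \<Rightarrow> bool" where
  "Ck_boundary k D \<longleftrightarrow>
     (\<forall>p \<in> frontier D. \<exists>U \<phi>. open U \<and> p \<in> U \<and> Ck_on k U \<phi> \<and>
        (\<forall>x\<in>U. grad \<phi> x \<noteq> 0) \<and> D \<inter> U = {x \<in> U. \<phi> x < 0})"

(* Tetrahedra are closed, and two of them meet in a common face (possibly empty). *)
definition tetrahedral_mesh :: "R3 set \<Rightarrow> R3 set set \<Rightarrow> bool" where
  "tetrahedral_mesh D \<T> \<longleftrightarrow>
     triangulation \<T> \<and> (\<forall>T\<in>\<T>. 3 simplex T) \<and> \<Union>\<T> = closure D"

definition inscribed_diameter :: "R3 set \<Rightarrow> real" where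
  "inscribed_diameter T = Sup {2 * r | r. 0 \<le> r \<and> (\<exists>x. cball x r \<subseteq> T)}"

definition shape_regular :: "(real \<Rightarrow> R3 set set) \<Rightarrow> bool" where
  "shape_regular \<T> \<longleftrightarrow>
     (\<exists>\<sigma>. \<forall>h\<in>{0<..<1}. \<forall>T\<in>\<T> h. diameter T \<le> \<sigma> * inscribed_diameter T)"

(* Includes the requirement that the mesh with parameter h has size (at most) h. *)
definition quasi_uniform :: "(real \<Rightarrow> R3 set set) \<Rightarrow> bool" where
  "quasi_uniform \<T> \<longleftrightarrow>
     (\<exists>\<kappa>>0. \<forall>h\<in>{0<..<1}. \<forall>T\<in>\<T> h. \<kappa> * h \<le> diameter T \<and> diameter T \<le> h)"

(* Values outside the closure of D are irrelevant here. *)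
definition Vh :: "R3 set \<Rightarrow> R3 set set \<Rightarrow> (R3 \<Rightarrow> real) set" where
  "Vh D \<T> = {v. continuous_on (closure D) v \<and> (\<forall>T\<in>\<T>. \<exists>a b. \<forall>x\<in>T. v x = a \<bullet> x + b)}"

(* Functions in Vh0 are extended by zero to the whole space, so that a member is determined by
   its restriction to the open set D. *)
definition Vh0 :: "R3 set \<Rightarrow> R3 set set \<Rightarrow> (R3 \<Rightarrow> real) set" where
  "Vh0 D \<T> = {v \<in> Vh D \<T>. (\<forall>x \<in> frontier D. v x = 0) \<and> (\<forall>x. x \<notin> closure D \<longrightarrow> v x = 0)}"

(* The measure is the completed one because grad is unspecified on the faces of the mesh. *)
definition inner_L2 :: "R3 set \<Rightarrow> (R3 \<Rightarrow> R3) \<Rightarrow> (R3 \<Rightarrow> R3) \<Rightarrow> real" where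
  "inner_L2 \<Omega> u v = set_lebesgue_integral lebesgue \<Omega> (\<lambda>x. u x \<bullet> v x)"

definition discrete_green :: "R3 set \<Rightarrow> R3 set \<Rightarrow> R3 set set \<Rightarrow> R3 \<Rightarrow> (R3 \<Rightarrow> real)" where
  "discrete_green \<Omega> D \<T> z =
     (THE G. G \<in> Vh0 D \<T> \<and> (\<forall>v \<in> Vh0 D \<T>. inner_L2 \<Omega> (grad G) (grad v) = v z))"

end

theory Submission
  imports Defs
begin

text \<open>
Testing the defining equation of \<open>G = G_h^z\<close> with \<open>G\<close> itself shows that \<open>G z\<close> is the Dirichlet
energy of \<open>G\<close>. The theorem therefore follows from the discrete Sobolev inequality
\<open>(v x)\<^sup>2 \<le> (K / h) * E v\<close> for finite element functions \<open>v\<close> with zero boundary values, where \<open>E v\<close>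
is the energy of \<open>v\<close>: it gives \<open>(G z)\<^sup>2 \<le> (K / h) * G z\<close> (\<open>discrete_green_diagonal_le\<close>). The inequality also
makes the Dirichlet form definite, so that \<open>G\<close> exists and is unique by a finite-dimensional
Riesz argument (\<open>riesz_representation_finite_points\<close>).

The textbook route to the inequality combines an inverse estimate with the Sobolev embedding into
\<open>L^6\<close>. Here it is proved directly (\<open>value_le_energy\<close>). Up to a constant, a function of compact support
is bounded at \<open>x\<close> by the integral of \<open>|grad v| / r\<^sup>2\<close>, where \<open>r\<close> is the distance from \<open>x\<close>; this follows by
integrating the derivative along all rays that leave \<open>x\<close>. The kernel \<open>1 / r\<^sup>2\<close> is not square integrable near the
pole. Beyond distance \<open>h\<close> its square integrates to a multiple of \<open>1 / h\<close>, and Cauchy-Schwarz gives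
the claim. Within distance \<open>h\<close> the gradient is bounded pointwise: one element has volume at least \<open>c * h ^ 3\<close>,
so the slopes are at most a multiple of \<open>h powr (- 3/2) * sqrt (E v)\<close>, and the function varies by at most a
multiple of \<open>sqrt (E v / h)\<close> over this distance. To avoid polar coordinates, the rays are parametrised
by directions in a cube of volume one, and Cauchy-Schwarz is applied as a weighted inequality
between arithmetic and geometric mean.

For a piecewise affine function, all of this reduces to volumes of elements: the energy is the sum
of the element volumes times the squared slopes (\<open>inner_L2_grad_eq_sum\<close>), and the volumes
are bounded from below by shape regularity and quasi-uniformity (\<open>uniform_element_volume\<close>).
\<close>

section \<open>Representation of functionals on a function space separated by finitely many points\<close>

text \<open>In a space of functions that finitely many point evaluations separate,
a definite symmetric form represents every linear functional. The induction removes one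
evaluation point \<open>p\<close> at a time: the functions vanishing at \<open>p\<close> form a subspace separated by the
remaining points, and a single further direction orthogonal to it suffices to reach every function.
Working with separating points makes finite dimensionality usable for a set of plain functions,
without a basis or a vector space type.\<close>

lemma riesz_representation_finite_points:
  fixes B :: "('a \<Rightarrow> real) \<Rightarrow> ('a \<Rightarrow> real) \<Rightarrow> real"
  assumes "finite P"
    and "\<And>u v c. u \<in> W \<Longrightarrow> v \<in> W \<Longrightarrow> (\<lambda>x. u x + c * v x) \<in> W" and "(\<lambda>_. 0) \<in> W"
    and "\<And>u v. B u v = B v u"
    and "\<And>u v w c. u \<in> W \<Longrightarrow> v \<in> W \<Longrightarrow> w \<in> W \<Longrightarrow>
           B (\<lambda>x. u x + c * v x) w = B u w + c * B v w"
    and "\<And>u. u \<in> W \<Longrightarrow> B u u = 0 \<Longrightarrow> u = (\<lambda>_. 0)"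
    and "\<And>u. u \<in> W \<Longrightarrow> (\<And>p. p \<in> P \<Longrightarrow> u p = 0) \<Longrightarrow> u = (\<lambda>_. 0)"
    and "\<And>u v c. u \<in> W \<Longrightarrow> v \<in> W \<Longrightarrow> L (\<lambda>x. u x + c * v x) = L u + c * L v"
  shows "\<exists>G\<in>W. \<forall>v\<in>W. B G v = (L v :: real)"
  using assms
proof (induction P arbitrary: W L rule: finite_induct)
  case empty
  note lin = empty.prems(4) and linL = empty.prems(7)
  have W: "u = (\<lambda>_. 0)" if "u \<in> W" for u
    using empty.prems(6) that by simp
  have "B (\<lambda>_. 0) (\<lambda>_. 0) = 0" "L (\<lambda>_. 0) = 0"
    using lin[of "\<lambda>_. 0" "\<lambda>_. 0" "\<lambda>_. 0" 1] linL[of "\<lambda>_. 0" "\<lambda>_. 0" 1] \<open>(\<lambda>_. 0) \<in> W\<close> by auto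
  then show ?case
    using W \<open>(\<lambda>_. 0) \<in> W\<close> by metis
next
  case (insert p P)
  note closed = insert.prems(1) and lin = insert.prems(4) and linL = insert.prems(7)
    and sym = insert.prems(3)
  define W' where "W' = {u \<in> W. u p = 0}"
  \<comment> \<open>the induction hypothesis for \<open>W'\<close>, where evaluation at \<open>p\<close> is redundant\<close>
  have representer: "\<exists>G\<in>W'. \<forall>v\<in>W'. B G v = M v"
    if M: "\<And>u v c. u \<in> W \<Longrightarrow> v \<in> W \<Longrightarrow> M (\<lambda>x. u x + c * v x) = M u + c * M v" for M
  proof (rule insert.IH)
    show "u = (\<lambda>_. 0)" if "u \<in> W'" "\<And>q. q \<in> P \<Longrightarrow> u q = 0" for u
      using insert.prems(6)[of u] that by (auto simp: W'_def)
    show "u = (\<lambda>_. 0)" if "u \<in> W'" "B u u = 0" for u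
      using insert.prems(5)[of u] that by (auto simp: W'_def)
    show "(\<lambda>x. u x + c * w x) \<in> W'" if "u \<in> W'" "w \<in> W'" for u w c
      using closed[of u w c] that by (auto simp: W'_def)
    show "B u w = B w u" for u w
      by (rule sym)
    show "B (\<lambda>x. u x + c * u' x) w = B u w + c * B u' w"
      if "u \<in> W'" "u' \<in> W'" "w \<in> W'" for u u' w c
      using lin[of u u' w c] that by (auto simp: W'_def)
    show "(\<lambda>_. 0) \<in> W'"
      using insert.prems(2) by (auto simp: W'_def)
    show "M (\<lambda>x. u x + c * w x) = M u + c * M w" if "u \<in> W'" "w \<in> W'" for u w c
      using M[of u w c] that by (auto simp: W'_def)
  qed
  show ?case
  proof (cases "W' = W")
    case True
    then show ?thesis
      using representer[of L] linL by simp
  next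
    case False
    then obtain w0 where w0: "w0 \<in> W" "w0 p \<noteq> 0"
      by (auto simp: W'_def)
    define w1 where "w1 = (\<lambda>x. 0 + inverse (w0 p) * w0 x)"
    have w1: "w1 \<in> W" "w1 p = 1"
      unfolding w1_def using closed[OF insert.prems(2) w0(1)] w0 by auto
    have linr: "B w (\<lambda>x. u x + c * v x) = B w u + c * B w v" if "u \<in> W" "v \<in> W" "w \<in> W" for u v w c
      using lin[OF that] sym by metis
    obtain q where q: "q \<in> W'" "\<forall>v\<in>W'. B q v = B w1 v"
      using representer[of "B w1"] linr w1 by blast
    \<comment> \<open>subtracting the projection makes \<open>w1\<close> orthogonal to \<open>W'\<close> without changing its value at \<open>p\<close>\<close>
    define w where "w = (\<lambda>x. w1 x + (-1) * q x)"
    have qW: "q \<in> W" using q by (simp add: W'_def)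
    have wW: "w \<in> W" unfolding w_def by (rule closed[OF w1(1) qW])
    have wp: "w p = 1" using w1 q by (simp add: w_def W'_def)
    have orth: "B w v = 0" if "v \<in> W'" for v
    proof -
      have "v \<in> W" using that by (simp add: W'_def)
      then show ?thesis
        using lin[OF w1(1) qW, of v "-1"] q that by (simp add: w_def)
    qed
    have Bw: "B w w \<noteq> 0"
      using insert.prems(5)[OF wW] wp by (metis zero_neq_one)
    obtain G' where G': "G' \<in> W'" "\<forall>v\<in>W'. B G' v = L v"
      using representer[of L] linL by blast
    have G'W: "G' \<in> W" using G' by (simp add: W'_def)
    define c where "c = L w / B w w"
    have "B (\<lambda>x. G' x + c * w x) v = L v" if v: "v \<in> W" for v
    proof -
      define v' where "v' = (\<lambda>x. v x + (- v p) * w x)"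
      have v'W: "v' \<in> W" unfolding v'_def by (rule closed[OF v wW])
      then have v': "v' \<in> W'" using wp by (simp add: W'_def v'_def)
      have veq: "v = (\<lambda>x. v' x + v p * w x)" by (simp add: v'_def)
      have "B G' v = L v'"
      proof -
        have "B G' v = B G' v' + v p * B G' w"
          using linr[OF v'W wW G'W, of "v p"] veq by simp
        moreover have "B G' w = 0" using orth[OF G'(1)] sym by metis
        ultimately show ?thesis using G' v' by simp
      qed
      moreover have "B w v = v p * B w w"
        using linr[OF v'W wW wW, of "v p"] veq orth[OF v'] by simp
      moreover have "L v = L v' + v p * L w"
        using linL[OF v'W wW, of "v p"] veq by simp
      ultimately show ?thesis
        using lin[OF G'W wW v, of c] Bw by (simp add: c_def)
    qed
    then show ?thesis
      using closed[OF G'W wW, of c] by blast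
  qed
qed


section \<open>Piecewise affine functions along lines\<close>

text \<open>The slopes \<open>a T\<close> belong to the data, so that the estimates below can be stated in terms
of them instead of the gradient, which need not exist on the faces between pieces.\<close>

locale piecewise_affine =
  fixes \<T> :: "'a::euclidean_space set set" and v :: "'a \<Rightarrow> real" and a :: "'a set \<Rightarrow> 'a"
  assumes finite: "finite \<T>"
    and compact: "\<And>T. T \<in> \<T> \<Longrightarrow> compact T"
    and convex: "\<And>T. T \<in> \<T> \<Longrightarrow> convex T"
    and continuous: "continuous_on UNIV v"
    and affine: "\<And>T x y. T \<in> \<T> \<Longrightarrow> x \<in> T \<Longrightarrow> y \<in> T \<Longrightarrow> v x - v y = a T \<bullet> (x - y)"
    and vanish: "\<And>x. x \<notin> \<Union>\<T> \<Longrightarrow> v x = 0"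
begin

lemma ray_meets_in_interval:
  assumes "T \<in> \<T>"
  shows "\<exists>l u. {r. z + r *\<^sub>R y \<in> T} \<inter> {s..t} = {l..u::real}"
proof -
  have cont: "continuous_on UNIV (\<lambda>r. z + r *\<^sub>R y)"
    by (intro continuous_intros)
  have "closed ((\<lambda>r. z + r *\<^sub>R y) -` T)"
    using continuous_closed_vimage[of T "\<lambda>r. z + r *\<^sub>R y"] compact_imp_closed[OF compact[OF assms]]
    by (simp add: continuous_intros)
  then have "compact ({r. z + r *\<^sub>R y \<in> T} \<inter> {s..t})"
    by (simp add: vimage_def closed_Int_compact)
  moreover have "convex {r. z + r *\<^sub>R y \<in> T}"
  proof (rule convexI)
    fix r r' p q :: real
    assume h: "r \<in> {r. z + r *\<^sub>R y \<in> T}" "r' \<in> {r. z + r *\<^sub>R y \<in> T}" "0 \<le> p" "0 \<le> q" "p + q = 1"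
    have "p *\<^sub>R (z + r *\<^sub>R y) + q *\<^sub>R (z + r' *\<^sub>R y) \<in> T"
      using convexD[OF convex[OF assms]] h by auto
    moreover have "p *\<^sub>R (z + r *\<^sub>R y) + q *\<^sub>R (z + r' *\<^sub>R y) = (p + q) *\<^sub>R z + (p * r + q * r') *\<^sub>R y"
      by (simp add: algebra_simps)
    ultimately show "p *\<^sub>R r + q *\<^sub>R r' \<in> {r. z + r *\<^sub>R y \<in> T}"
      using h by simp
  qed
  then have "connected ({r. z + r *\<^sub>R y \<in> T} \<inter> {s..t})"
    by (intro convex_connected convex_Int) auto
  ultimately show ?thesis
    using connected_compact_interval_1 by blast
qed

text \<open>A line meets each piece in an interval, so away from finitely many parameters the
function is differentiable along the line, with derivative \<open>a T \<bullet> y\<close> or zero, and the fundamental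
theorem of calculus applies. Comparing with every piece containing the point makes the bound valid
even for lines that run inside a common face.\<close>

lemma increment_le_integral:
  assumes "s \<le> t" and psi: "\<psi> integrable_on {s..t}"
    and nonneg: "\<And>r. r \<in> {s..t} \<Longrightarrow> 0 \<le> \<psi> r"
    and slope: "\<And>r T. r \<in> {s..t} \<Longrightarrow> T \<in> \<T> \<Longrightarrow> z + r *\<^sub>R y \<in> T \<Longrightarrow> \<bar>a T \<bullet> y\<bar> \<le> \<psi> r"
  shows "\<bar>v (z + t *\<^sub>R y) - v (z + s *\<^sub>R y)\<bar> \<le> integral {s..t} \<psi>"
proof -
  define \<phi> where "\<phi> r = v (z + r *\<^sub>R y)" for r
  obtain l u where lu: "\<And>T. T \<in> \<T> \<Longrightarrow> {r. z + r *\<^sub>R y \<in> T} \<inter> {s..t} = {l T..u T}"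
    using ray_meets_in_interval[of _ z y s t] by metis
  define S where "S = l ` \<T> \<union> u ` \<T>"
  have "finite S"
    using finite by (simp add: S_def)
  have "\<exists>d. (\<phi> has_vector_derivative d) (at r) \<and> \<bar>d\<bar> \<le> \<psi> r" if r: "r \<in> {s<..<t} - S" for r
  proof (cases "\<exists>T\<in>\<T>. z + r *\<^sub>R y \<in> T")
    case True
    then obtain T where T: "T \<in> \<T>" "z + r *\<^sub>R y \<in> T" by blast
    have "r \<in> {l T..u T}" "r \<noteq> l T" "r \<noteq> u T"
      using lu[OF T(1)] T r by (auto simp: S_def)
    then have r': "r \<in> {l T<..<u T}" by auto
    have in_T: "z + q *\<^sub>R y \<in> T" if "q \<in> {l T<..<u T}" for q
    proof -
      have "q \<in> {l T..u T}" using that by auto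
      then show ?thesis unfolding lu[OF T(1), symmetric] by simp
    qed
    have "((\<lambda>q. \<phi> r + (q - r) * (a T \<bullet> y)) has_vector_derivative (a T \<bullet> y)) (at r)"
      by (auto intro!: derivative_eq_intros simp: has_real_derivative_iff_has_vector_derivative[symmetric])
    moreover have "\<phi> r + (q - r) * (a T \<bullet> y) = \<phi> q" if "q \<in> {l T<..<u T}" for q
      using affine[OF T(1) in_T[OF that] T(2)] by (simp add: \<phi>_def algebra_simps)
    ultimately have "(\<phi> has_vector_derivative (a T \<bullet> y)) (at r)"
      by (rule has_vector_derivative_transform_within_open[OF _ open_greaterThanLessThan r'])
    then show ?thesis
      using slope[OF _ T] r by (intro exI[of _ "a T \<bullet> y"]) auto
  next
    case False
    \<comment> \<open>off the closed support the function vanishes near the point\<close>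
    define O' where "O' = (\<lambda>q. z + q *\<^sub>R y) -` (- \<Union>\<T>)"
    have "closed (\<Union>\<T>)"
      using finite compact by (intro closed_Union) (auto intro: compact_imp_closed)
    then have O': "open O'"
      unfolding O'_def by (intro open_vimage) (auto intro!: continuous_intros)
    have O'r: "r \<in> O'" using False by (auto simp: O'_def)
    have \<phi>0: "0 = \<phi> q" if "q \<in> O'" for q
      using vanish that by (auto simp: O'_def \<phi>_def)
    have "((\<lambda>_. 0::real) has_vector_derivative 0) (at r)" by simp
    then have "(\<phi> has_vector_derivative 0) (at r)"
      by (rule has_vector_derivative_transform_within_open[OF _ O' O'r \<phi>0])
    then show ?thesis
      using nonneg[of r] r by (intro exI[of _ 0]) auto
  qed
  then obtain d where d: "\<And>r. r \<in> {s<..<t} - S \<Longrightarrow> (\<phi> has_vector_derivative d r) (at r) \<and> \<bar>d r\<bar> \<le> \<psi> r"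
    by metis
  define d' where "d' r = (if r \<in> {s<..<t} - S then d r else 0)" for r
  have "(d' has_integral (\<phi> t - \<phi> s)) {s..t}"
  proof (rule fundamental_theorem_of_calculus_interior_strong[OF \<open>finite S\<close> \<open>s \<le> t\<close>])
    show "continuous_on {s..t} \<phi>"
      unfolding \<phi>_def by (intro continuous_on_compose2[OF continuous] continuous_intros) auto
  qed (use d in \<open>auto simp: d'_def\<close>)
  moreover have "norm (integral {s..t} d') \<le> integral {s..t} \<psi>"
    using calculation psi d nonneg
    by (intro integral_norm_bound_integral) (auto simp: d'_def)
  ultimately show ?thesis
    by (simp add: \<phi>_def integral_unique)
qed

end


section \<open>The discrete Sobolev inequality\<close>

lemma nn_integral_indicator_scaled:
  fixes z :: "'a::euclidean_space"
  assumes [measurable]: "T \<in> sets borel" and "0 < r"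
  shows "ennreal (r ^ DIM('a)) * (\<integral>\<^sup>+y. indicator T (z + r *\<^sub>R y) \<partial>lborel) = emeasure lborel T"
proof -
  have "emeasure lborel T = (\<integral>\<^sup>+y. indicator T y \<partial>lborel)"
    by simp
  also have "\<dots> = (\<integral>\<^sup>+y. indicator T y
      \<partial>density (distr lborel borel (\<lambda>x. z + r *\<^sub>R x)) (\<lambda>_. ennreal (\<bar>r\<bar> ^ DIM('a))))"
    using lborel_affine[of r z] \<open>0 < r\<close> by simp
  also have "\<dots> = ennreal (r ^ DIM('a)) * (\<integral>\<^sup>+y. indicator T (z + r *\<^sub>R y) \<partial>lborel)"
    using \<open>0 < r\<close>
    by (subst nn_integral_density) (simp_all add: nn_integral_distr nn_integral_cmult del: nn_integral_indicator)
  finally show ?thesis by simp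
qed

lemma weight_tail:
  fixes h R :: real
  assumes "0 < h" "h \<le> R"
  shows "((\<lambda>r. 1 / (r * sqrt r)) has_integral (2 / sqrt h - 2 / sqrt R)) {h..R}"
proof -
  have "((\<lambda>r. 1 / (r * sqrt r)) has_integral ((- 2 / sqrt R) - (- 2 / sqrt h))) {h..R}"
  proof (rule fundamental_theorem_of_calculus[OF \<open>h \<le> R\<close>])
    fix r assume "r \<in> {h..R}"
    then have "r > 0" using assms by simp
    then show "((\<lambda>r. - 2 / sqrt r) has_vector_derivative 1 / (r * sqrt r)) (at r within {h..R})"
      unfolding has_real_derivative_iff_has_vector_derivative[symmetric]
      by (auto intro!: derivative_eq_intros simp: field_simps)
  qed
  then show ?thesis by simp
qed

text \<open>The finite bound \<open>2 / sqrt h\<close>, uniform in \<open>R\<close>, is where the final rate in \<open>h\<close> comes from.\<close>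

lemma nn_integral_weight_tail:
  fixes h R :: real
  assumes "0 < h" "h \<le> R"
  shows "(\<integral>\<^sup>+r. ennreal (1 / (r * sqrt r)) * indicator {h..R} r \<partial>lborel) \<le> ennreal (2 / sqrt h)"
proof -
  have "(\<integral>\<^sup>+r. ennreal (1 / (r * sqrt r)) * indicator {h..R} r \<partial>lborel)
      = (\<integral>\<^sup>+r. ennreal (if r \<in> {h..R} then 1 / (r * sqrt r) else 0) \<partial>lborel)"
    by (intro nn_integral_cong) (auto simp: indicator_def)
  also have "\<dots> = ennreal (2 / sqrt h - 2 / sqrt R)"
  proof (rule nn_integral_has_integral_lborel)
    show "((\<lambda>r. if r \<in> {h..R} then 1 / (r * sqrt r) else 0) has_integral (2 / sqrt h - 2 / sqrt R)) UNIV"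
      using weight_tail[OF assms] by (simp only: has_integral_restrict_UNIV)
  qed (use assms in auto)
  also have "\<dots> \<le> ennreal (2 / sqrt h)"
    using assms by (intro ennreal_leI) simp
  finally show ?thesis .
qed

text \<open>By Tonelli, the directions can be integrated first. At distance \<open>r\<close> this gives at most the
volume of \<open>T\<close> over \<open>r ^ 3\<close>, and the weight \<open>r * sqrt r\<close> turns this factor into an integrable one.\<close>

lemma weighted_ray_integral_average:
  fixes z :: "'a::euclidean_space"
  assumes dim: "DIM('a) = 3" and [measurable]: "T \<in> sets borel" "A \<in> sets borel"
    and h: "0 < h" "h \<le> R"
  shows "(\<integral>\<^sup>+y. indicator A y *
            (\<integral>\<^sup>+r. ennreal (r * sqrt r) * indicator {h..R} r * indicator T (z + r *\<^sub>R y) \<partial>lborel) \<partial>lborel)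
         \<le> ennreal (2 / sqrt h) * emeasure lborel T"
proof -
  have "(\<integral>\<^sup>+y. indicator A y *
            (\<integral>\<^sup>+r. ennreal (r * sqrt r) * indicator {h..R} r * indicator T (z + r *\<^sub>R y) \<partial>lborel) \<partial>lborel)
      \<le> (\<integral>\<^sup>+y. (\<integral>\<^sup>+r. ennreal (r * sqrt r) * indicator {h..R} r * indicator T (z + r *\<^sub>R y) \<partial>lborel) \<partial>lborel)"
    by (intro nn_integral_mono) (auto simp: indicator_def)
  also have "\<dots> = (\<integral>\<^sup>+r. (\<integral>\<^sup>+y. ennreal (r * sqrt r) * indicator {h..R} r * indicator T (z + r *\<^sub>R y) \<partial>lborel) \<partial>lborel)"
    by (rule lborel_pair.Fubini'[symmetric]) measurable
  also have "\<dots> = (\<integral>\<^sup>+r. (ennreal (1 / (r * sqrt r)) * indicator {h..R} r) * emeasure lborel T \<partial>lborel)"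
  proof (intro nn_integral_cong)
    fix r :: real
    show "(\<integral>\<^sup>+y. ennreal (r * sqrt r) * indicator {h..R} r * indicator T (z + r *\<^sub>R y) \<partial>lborel)
        = (ennreal (1 / (r * sqrt r)) * indicator {h..R} r) * emeasure lborel T"
    proof (cases "r \<in> {h..R}")
      case True
      then have r: "r > 0" using h by auto
      have "r * sqrt r = 1 / (r * sqrt r) * r ^ 3"
        using r by (simp add: field_simps power3_eq_cube)
      then have w: "ennreal (r * sqrt r) = ennreal (1 / (r * sqrt r)) * ennreal (r ^ 3)"
        using r by (metis divide_nonneg_nonneg ennreal_mult less_eq_real_def mult_nonneg_nonneg real_sqrt_ge_zero zero_le_one zero_le_power)
      have "(\<integral>\<^sup>+y. ennreal (r * sqrt r) * indicator {h..R} r * indicator T (z + r *\<^sub>R y) \<partial>lborel)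
          = ennreal (r * sqrt r) * (\<integral>\<^sup>+y. indicator T (z + r *\<^sub>R y) \<partial>lborel)"
        using True by (simp add: nn_integral_cmult)
      also have "\<dots> = ennreal (1 / (r * sqrt r)) * (ennreal (r ^ 3) * (\<integral>\<^sup>+y. indicator T (z + r *\<^sub>R y) \<partial>lborel))"
        by (simp add: w mult.assoc)
      also have "\<dots> = ennreal (1 / (r * sqrt r)) * emeasure lborel T"
        using nn_integral_indicator_scaled[of T r z] r dim by simp
      finally show ?thesis using True by simp
    qed simp
  qed
  also have "\<dots> = (\<integral>\<^sup>+r. ennreal (1 / (r * sqrt r)) * indicator {h..R} r \<partial>lborel) * emeasure lborel T"
    by (rule nn_integral_multc) measurable
  also have "\<dots> \<le> ennreal (2 / sqrt h) * emeasure lborel T"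
    by (intro mult_right_mono nn_integral_weight_tail h) simp
  finally show ?thesis .
qed

context piecewise_affine
begin

definition energy :: real where
  "energy = (\<Sum>T\<in>\<T>. measure lborel T * (norm (a T))\<^sup>2)"

lemma energy_nonneg: "0 \<le> energy"
  by (auto simp: energy_def intro!: sum_nonneg)

text \<open>Follow the ray from \<open>z\<close> in direction \<open>y\<close> until it has left the support. On the first stretch,
up to parameter \<open>h\<close>, the pointwise slope bound \<open>M\<close> limits the change of the function to \<open>6 * M * h\<close>. On the
rest, the inequality \<open>2 * s \<le> N / w + (w / N) * s\<^sup>2\<close> with \<open>w = r * sqrt r\<close> replaces the slope by its square.
This is Cauchy-Schwarz with an explicit weight; \<open>N\<close> stands for an upper bound on the square root
of the energy.\<close>

lemma value_le_ray_integral: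
  assumes y: "norm y \<le> 6" "z + R *\<^sub>R y \<notin> \<Union>\<T>" and h: "0 < h" "h \<le> R"
    and M: "\<And>T. T \<in> \<T> \<Longrightarrow> norm (a T) \<le> M" "0 \<le> M" and N: "0 < N"
  shows "ennreal \<bar>v z\<bar> \<le> ennreal (6 * M * h + 6 * N / sqrt h)
      + (\<Sum>T\<in>\<T>. ennreal (3 / N * (norm (a T))\<^sup>2)
          * (\<integral>\<^sup>+r. ennreal (r * sqrt r) * indicator {h..R} r * indicator T (z + r *\<^sub>R y) \<partial>lborel))"
proof -
  have "\<bar>v (z + h *\<^sub>R y) - v (z + 0 *\<^sub>R y)\<bar> \<le> integral {0..h} (\<lambda>_. 6 * M)"
  proof (rule increment_le_integral)
    fix r T assume T: "T \<in> \<T>"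
    have "\<bar>a T \<bullet> y\<bar> \<le> norm (a T) * norm y" by (rule Cauchy_Schwarz_ineq2)
    also have "\<dots> \<le> M * 6" using M T y by (intro mult_mono) auto
    finally show "\<bar>a T \<bullet> y\<bar> \<le> 6 * M" by simp
  qed (use h M in auto)
  then have near: "\<bar>v z\<bar> \<le> \<bar>v (z + h *\<^sub>R y)\<bar> + 6 * M * h"
    using h by (simp add: mult_ac)
  define f where "f T r = r * sqrt r * indicator T (z + r *\<^sub>R y)" for T r
  define \<psi> where "\<psi> r = 3 * N * (1 / (r * sqrt r)) + (\<Sum>T\<in>\<T>. 3 / N * (norm (a T))\<^sup>2 * f T r)" for r
  have f_int: "f T integrable_on {h..R}" if T: "T \<in> \<T>" for T
  proof -
    obtain l u where lu: "{r. z + r *\<^sub>R y \<in> T} \<inter> {h..R} = {l..u}"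
      using ray_meets_in_interval[OF T] by blast
    have "(\<lambda>r. r * sqrt r) integrable_on {l..u}"
      by (intro integrable_continuous_interval continuous_intros)
    then have "(\<lambda>r. if r \<in> {r. z + r *\<^sub>R y \<in> T} \<inter> {h..R} then r * sqrt r else 0) integrable_on UNIV"
      unfolding lu integrable_restrict_UNIV .
    moreover have "(\<lambda>r. if r \<in> {r. z + r *\<^sub>R y \<in> T} \<inter> {h..R} then r * sqrt r else 0)
        = (\<lambda>r. if r \<in> {h..R} then f T r else 0)"
      by (auto simp: f_def indicator_def)
    ultimately show ?thesis
      by (simp only: integrable_restrict_UNIV)
  qed
  have f_nn: "0 \<le> f T r" if "r \<in> {h..R}" for T r
    using that h by (auto simp: f_def)
  note tail = weight_tail[OF h]
  have psi: "(\<psi> has_integral (3 * N * (2 / sqrt h - 2 / sqrt R)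
      + (\<Sum>T\<in>\<T>. 3 / N * (norm (a T))\<^sup>2 * integral {h..R} (f T)))) {h..R}"
    unfolding \<psi>_def
    by (intro has_integral_add has_integral_sum has_integral_mult_right tail finite
        integrable_integral f_int)
  have "\<bar>v (z + R *\<^sub>R y) - v (z + h *\<^sub>R y)\<bar> \<le> integral {h..R} \<psi>"
  proof (rule increment_le_integral)
    show "\<psi> integrable_on {h..R}" using psi by blast
    show "0 \<le> \<psi> r" if "r \<in> {h..R}" for r
      unfolding \<psi>_def using that h N f_nn by (intro add_nonneg_nonneg sum_nonneg mult_nonneg_nonneg) auto
    fix r T assume r: "r \<in> {h..R}" and T: "T \<in> \<T>" "z + r *\<^sub>R y \<in> T"
    define w where "w = r * sqrt r"
    have w: "w > 0" using r h by (simp add: w_def)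
    have "\<bar>a T \<bullet> y\<bar> \<le> norm (a T) * norm y" by (rule Cauchy_Schwarz_ineq2)
    also have "\<dots> \<le> 6 * norm (a T)" using mult_left_mono[OF y(1), of "norm (a T)"] by simp
    also have "\<dots> \<le> 3 * N * (1 / w) + 3 / N * (norm (a T))\<^sup>2 * w"
    proof -
      have "0 \<le> 3 / (N * w) * (N - w * norm (a T))\<^sup>2" using w N by simp
      also have "\<dots> = 3 * N * (1 / w) + 3 / N * (norm (a T))\<^sup>2 * w - 6 * norm (a T)"
        using w N by (simp add: field_simps power2_eq_square)
      finally show ?thesis by simp
    qed
    also have "3 / N * (norm (a T))\<^sup>2 * w = 3 / N * (norm (a T))\<^sup>2 * f T r"
      using T by (simp add: f_def w_def)
    also have "\<dots> \<le> (\<Sum>T\<in>\<T>. 3 / N * (norm (a T))\<^sup>2 * f T r)"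
      using N f_nn[OF r] finite T by (intro member_le_sum) auto
    finally show "\<bar>a T \<bullet> y\<bar> \<le> \<psi> r" by (simp add: \<psi>_def w_def)
  qed (use h in simp)
  then have "\<bar>v (z + h *\<^sub>R y)\<bar> \<le> 3 * N * (2 / sqrt h - 2 / sqrt R)
      + (\<Sum>T\<in>\<T>. 3 / N * (norm (a T))\<^sup>2 * integral {h..R} (f T))"
    using vanish[OF y(2)] integral_unique[OF psi] by simp
  also have "3 * N * (2 / sqrt h - 2 / sqrt R) \<le> 6 * N / sqrt h"
    using N h by (simp add: field_simps)
  finally have "\<bar>v z\<bar> \<le> (6 * M * h + 6 * N / sqrt h) + (\<Sum>T\<in>\<T>. 3 / N * (norm (a T))\<^sup>2 * integral {h..R} (f T))"
    using near by simp
  then have "ennreal \<bar>v z\<bar> \<le> ennreal ((6 * M * h + 6 * N / sqrt h)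
      + (\<Sum>T\<in>\<T>. 3 / N * (norm (a T))\<^sup>2 * integral {h..R} (f T)))"
    by (rule ennreal_leI)
  also have "\<dots> = ennreal (6 * M * h + 6 * N / sqrt h)
      + (\<Sum>T\<in>\<T>. ennreal (3 / N * (norm (a T))\<^sup>2) * ennreal (integral {h..R} (f T)))"
  proof -
    have I: "0 \<le> integral {h..R} (f T)" if "T \<in> \<T>" for T
      using f_nn f_int[OF that] by (intro integral_nonneg) auto
    have "ennreal (\<Sum>T\<in>\<T>. 3 / N * (norm (a T))\<^sup>2 * integral {h..R} (f T))
        = (\<Sum>T\<in>\<T>. ennreal (3 / N * (norm (a T))\<^sup>2 * integral {h..R} (f T)))"
      using I N by (subst sum_ennreal) auto
    also have "\<dots> = (\<Sum>T\<in>\<T>. ennreal (3 / N * (norm (a T))\<^sup>2) * ennreal (integral {h..R} (f T)))"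
      using I N by (intro sum.cong refl ennreal_mult) auto
    finally show ?thesis
      using I N h M by (subst ennreal_plus) (auto intro!: sum_nonneg)
  qed
  also have "(\<Sum>T\<in>\<T>. ennreal (3 / N * (norm (a T))\<^sup>2) * ennreal (integral {h..R} (f T)))
      = (\<Sum>T\<in>\<T>. ennreal (3 / N * (norm (a T))\<^sup>2)
          * (\<integral>\<^sup>+r. ennreal (r * sqrt r) * indicator {h..R} r * indicator T (z + r *\<^sub>R y) \<partial>lborel))"
  proof (intro sum.cong refl arg_cong2[where f="(*)"])
    fix T assume T: "T \<in> \<T>"
    have [measurable]: "T \<in> sets borel"
      using compact[OF T] by (intro borel_closed compact_imp_closed)
    have "(\<integral>\<^sup>+r. ennreal (if r \<in> {h..R} then f T r else 0) \<partial>lborel) = ennreal (integral {h..R} (f T))"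
    proof (rule nn_integral_has_integral_lborel)
      show "(\<lambda>r. if r \<in> {h..R} then f T r else 0) \<in> borel_measurable borel"
        unfolding f_def by measurable
      show "((\<lambda>r. if r \<in> {h..R} then f T r else 0) has_integral integral {h..R} (f T)) UNIV"
        using f_int[OF T] by (simp only: has_integral_restrict_UNIV integrable_integral)
    qed (use f_nn in auto)
    moreover have "(\<integral>\<^sup>+r. ennreal (if r \<in> {h..R} then f T r else 0) \<partial>lborel)
      = (\<integral>\<^sup>+r. ennreal (r * sqrt r) * indicator {h..R} r * indicator T (z + r *\<^sub>R y) \<partial>lborel)"
      by (intro nn_integral_cong) (auto simp: f_def indicator_def)
    ultimately show "ennreal (integral {h..R} (f T))
      = (\<integral>\<^sup>+r. ennreal (r * sqrt r) * indicator {h..R} r * indicator T (z + r *\<^sub>R y) \<partial>lborel)"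
      by simp
  qed
  finally show ?thesis .
qed

text \<open>Averaging the previous estimate over a unit-volume set of directions turns the ray
integrals into volumes, hence the sum of squared slopes into the energy. The slope bound \<open>M\<close> is itself
controlled by the energy, because no piece has volume below \<open>c * h ^ 3\<close>.\<close>

lemma value_le_sqrt_energy:
  assumes dim: "DIM('a) = 3" and h: "0 < h" and c: "0 < c"
    and vol: "\<And>T. T \<in> \<T> \<Longrightarrow> c * h ^ 3 \<le> measure lborel T"
    and N: "0 < N" "energy \<le> N\<^sup>2"
  shows "\<bar>v z\<bar> \<le> (6 / sqrt c + 12) * N / sqrt h"
proof -
  \<comment> \<open>a set of directions of volume one that stays away from the origin, so that rays leave the support\<close>
  define A where "A = cbox (One::'a) (2 *\<^sub>R One)"
  have A: "1 \<le> norm y" "norm y \<le> 6" if "y \<in> A" for y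
  proof -
    have yb: "1 \<le> y \<bullet> b \<and> y \<bullet> b \<le> 2" if "b \<in> Basis" for b
      using \<open>y \<in> A\<close> that by (auto simp: A_def mem_box)
    obtain b :: 'a where b: "b \<in> Basis" using nonempty_Basis by blast
    show "1 \<le> norm y"
      using Basis_le_norm[OF b, of y] yb[OF b] by simp
    have "norm y \<le> (\<Sum>b\<in>Basis. \<bar>y \<bullet> b\<bar>)" by (rule norm_le_l1)
    also have "\<dots> \<le> (\<Sum>b\<in>(Basis::'a set). 2)" using yb by (intro sum_mono) fastforce
    also have "\<dots> = 6" using dim by simp
    finally show "norm y \<le> 6" .
  qed
  have emA: "emeasure lborel A = 1"
    by (simp add: A_def emeasure_lborel_cbox_eq inner_diff_left)
  have [measurable]: "A \<in> sets borel" by (simp add: A_def)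
  have Tb: "T \<in> sets borel" if "T \<in> \<T>" for T
    using compact[OF that] by (intro borel_closed compact_imp_closed)
  \<comment> \<open>the energy of a single element is at least \<open>c * h ^ 3\<close> times its squared slope\<close>
  define M where "M = N / (sqrt c * (h * sqrt h))"
  have M: "norm (a T) \<le> M" if T: "T \<in> \<T>" for T
  proof -
    have "(c * h ^ 3) * (norm (a T))\<^sup>2 \<le> measure lborel T * (norm (a T))\<^sup>2"
      using vol[OF T] by (intro mult_right_mono) auto
    also have "\<dots> \<le> energy"
      unfolding energy_def using finite T by (intro member_le_sum) auto
    also have "\<dots> \<le> N\<^sup>2" by (rule N)
    also have "(c * h ^ 3) * (norm (a T))\<^sup>2 = (sqrt c * (h * sqrt h) * norm (a T))\<^sup>2"
      using h c by (simp add: power_mult_distrib power3_eq_cube) (simp add: power2_eq_square)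
    finally have "sqrt c * (h * sqrt h) * norm (a T) \<le> N"
      using N power2_le_imp_le by fastforce
    then show ?thesis
      using h c by (simp add: M_def field_simps)
  qed
  have M0: "0 \<le> M" using N h c by (simp add: M_def)
  have "bounded (\<Union>\<T>)"
    using finite compact by (intro bounded_Union) (auto intro: compact_imp_bounded)
  then obtain B where B: "\<And>x. x \<in> \<Union>\<T> \<Longrightarrow> norm x \<le> B"
    unfolding bounded_iff by blast
  define R where "R = max h (\<bar>B\<bar> + norm z + 1)"
  have R: "h \<le> R" by (simp add: R_def)
  have far: "z + R *\<^sub>R y \<notin> \<Union>\<T>" if "y \<in> A" for y
  proof
    assume "z + R *\<^sub>R y \<in> \<Union>\<T>"
    then have "norm (z + R *\<^sub>R y) \<le> B" by (rule B)
    moreover have "R * 1 \<le> R * norm y"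
      using A[OF that] h R by (intro mult_left_mono) auto
    moreover have "norm (R *\<^sub>R y) \<le> norm (z + R *\<^sub>R y) + norm z"
      by (metis add.commute add_diff_cancel_right' norm_triangle_ineq4)
    moreover have "R \<ge> 0" "R \<ge> \<bar>B\<bar> + norm z + 1" using h by (auto simp: R_def max_def)
    ultimately show False by simp
  qed
  let ?J = "\<lambda>T y. \<integral>\<^sup>+r. ennreal (r * sqrt r) * indicator {h..R} r * indicator T (z + r *\<^sub>R y) \<partial>lborel"
  define D where "D = 6 * M * h + 6 * N / sqrt h"
  have D: "0 \<le> D" using M0 h N by (simp add: D_def)
  have J[measurable]: "?J T \<in> borel_measurable lborel" if "T \<in> \<T>" for T
  proof -
    note [measurable] = Tb[OF that]
    show ?thesis by measurable
  qed
  have "ennreal \<bar>v z\<bar> = (\<integral>\<^sup>+y. indicator A y * ennreal \<bar>v z\<bar> \<partial>lborel)"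
    using emA by (simp add: nn_integral_multc)
  also have "\<dots> \<le> (\<integral>\<^sup>+y. indicator A y * ennreal D
      + (\<Sum>T\<in>\<T>. ennreal (3 / N * (norm (a T))\<^sup>2) * (indicator A y * ?J T y)) \<partial>lborel)"
  proof (intro nn_integral_mono)
    fix y :: 'a
    show "indicator A y * ennreal \<bar>v z\<bar> \<le> indicator A y * ennreal D
      + (\<Sum>T\<in>\<T>. ennreal (3 / N * (norm (a T))\<^sup>2) * (indicator A y * ?J T y))"
      using value_le_ray_integral[OF A(2) far h R M M0 N(1), of y]
      by (cases "y \<in> A") (auto simp: D_def)
  qed
  also have "\<dots> = ennreal D + (\<Sum>T\<in>\<T>. ennreal (3 / N * (norm (a T))\<^sup>2) * (\<integral>\<^sup>+y. indicator A y * ?J T y \<partial>lborel))"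
    using emA J by (simp add: nn_integral_add nn_integral_sum nn_integral_multc nn_integral_cmult)
  also have "\<dots> \<le> ennreal D + (\<Sum>T\<in>\<T>. ennreal (3 / N * (norm (a T))\<^sup>2) * (ennreal (2 / sqrt h) * emeasure lborel T))"
    using Tb R h dim by (intro add_left_mono sum_mono mult_left_mono weighted_ray_integral_average) auto
  also have "\<dots> = ennreal D + (\<Sum>T\<in>\<T>. ennreal (6 / (N * sqrt h) * (measure lborel T * (norm (a T))\<^sup>2)))"
  proof -
    have "ennreal (3 / N * (norm (a T))\<^sup>2) * (ennreal (2 / sqrt h) * emeasure lborel T)
        = ennreal (6 / (N * sqrt h) * (measure lborel T * (norm (a T))\<^sup>2))" if T: "T \<in> \<T>" for T
    proof -
      have "emeasure lborel T = ennreal (measure lborel T)"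
        using emeasure_bounded_finite[OF compact_imp_bounded[OF compact[OF T]]]
        by (simp add: emeasure_eq_ennreal_measure less_top[symmetric])
      then show ?thesis
        using N h by (simp add: ennreal_mult[symmetric] mult_ac)
    qed
    then show ?thesis by simp
  qed
  also have "\<dots> = ennreal (D + 6 / (N * sqrt h) * energy)"
  proof -
    have "(\<Sum>T\<in>\<T>. ennreal (6 / (N * sqrt h) * (measure lborel T * (norm (a T))\<^sup>2)))
        = ennreal (6 / (N * sqrt h) * energy)"
      using N h by (subst sum_ennreal) (auto simp: energy_def sum_distrib_left)
    then show ?thesis
      using D N h energy_nonneg by simp
  qed
  finally have "\<bar>v z\<bar> \<le> D + 6 / (N * sqrt h) * energy"
    using D N h energy_nonneg by (subst (asm) ennreal_le_iff) auto
  also have "\<dots> \<le> D + 6 / (N * sqrt h) * N\<^sup>2"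
    using N h by (intro add_left_mono mult_left_mono) auto
  also have "\<dots> = (6 / sqrt c + 12) * N / sqrt h"
    using N h c by (simp add: D_def M_def field_simps power2_eq_square)
  finally show ?thesis .
qed

text \<open>The discrete Sobolev inequality. The positive \<open>e\<close> in the proof only serves to keep
\<open>N\<close> positive when the energy vanishes.\<close>

lemma value_le_energy:
  assumes dim: "DIM('a) = 3" and h: "0 < h" and c: "0 < c"
    and vol: "\<And>T. T \<in> \<T> \<Longrightarrow> c * h ^ 3 \<le> measure lborel T"
  shows "(v z)\<^sup>2 \<le> (6 / sqrt c + 12)\<^sup>2 / h * energy"
proof (rule field_le_epsilon)
  fix e :: real assume e: "0 < e"
  define K where "K = (6 / sqrt c + 12)\<^sup>2 / h"
  have "0 < 6 / sqrt c + 12" using c by (simp add: add_pos_pos)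
  then have K: "0 < K" using h by (simp add: K_def)
  define N where "N = sqrt (energy + e / K)"
  have N2: "N\<^sup>2 = energy + e / K" using energy_nonneg e K by (simp add: N_def)
  have N: "0 < N" unfolding N_def using energy_nonneg e K by (simp add: add_nonneg_pos)
  have "\<bar>v z\<bar> \<le> (6 / sqrt c + 12) * N / sqrt h"
    using N N2 e K by (intro value_le_sqrt_energy dim h c vol) auto
  then have "\<bar>v z\<bar>\<^sup>2 \<le> ((6 / sqrt c + 12) * N / sqrt h)\<^sup>2"
    by (intro power_mono) auto
  also have "\<dots> = K * N\<^sup>2"
    using h by (simp add: K_def power_mult_distrib power_divide)
  also have "\<dots> = K * energy + e"
    using K by (simp add: N2 field_simps)
  finally show "(v z)\<^sup>2 \<le> (6 / sqrt c + 12)\<^sup>2 / h * energy + e"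
    by (simp add: K_def)
qed

end


section \<open>Finite element functions and their Dirichlet form\<close>

lemma grad_eqI:
  assumes "(f has_derivative (\<lambda>d. a \<bullet> d)) (at x)"
  shows "grad f x = a"
  by (simp add: grad_def frechet_derivative_at[OF assms, symmetric] vec_eq_iff inner_axis)

locale meshed_domain =
  fixes D :: "R3 set" and \<T> :: "R3 set set"
  assumes domain: "is_domain D" and mesh: "tetrahedral_mesh D \<T>"
begin

lemma finite_mesh: "finite \<T>"
  and mesh_cover: "\<Union>\<T> = closure D"
  using mesh unfolding tetrahedral_mesh_def triangulation_def by blast+

lemma mesh_face: "T \<in> \<T> \<Longrightarrow> T' \<in> \<T> \<Longrightarrow> T \<inter> T' face_of T"
  using mesh unfolding tetrahedral_mesh_def triangulation_def by blast

lemma mesh_simplex: "T \<in> \<T> \<Longrightarrow> 3 simplex T"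
  using mesh unfolding tetrahedral_mesh_def by blast

lemma element_compact: "T \<in> \<T> \<Longrightarrow> compact T"
  using mesh_simplex by (rule compact_simplex)

lemma element_convex: "T \<in> \<T> \<Longrightarrow> convex T"
  using mesh_simplex by (rule convex_simplex)

lemma element_interior:
  assumes "T \<in> \<T>" shows "interior T \<noteq> {}"
proof -
  obtain C where C: "\<not> affine_dependent C" "int (card C) = 3 + 1" "T = convex hull C"
    using mesh_simplex[OF assms] unfolding simplex_def by blast
  then have "card C = Suc DIM(R3)" by simp
  then show ?thesis
    using interior_convex_hull_eq_empty C by metis
qed

text \<open>A face of \<open>T\<close> that contains an interior point of \<open>T\<close> is all of \<open>T\<close>.\<close>

lemma element_subset_if_meets_interior:
  assumes "T \<in> \<T>" "T' \<in> \<T>" "x \<in> interior T" "x \<in> T'"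
  shows "T \<subseteq> T'"
proof -
  have "rel_interior T = interior T"
    using element_interior[OF assms(1)] by (rule rel_interior_nonempty_interior)
  then have "T \<subseteq> T \<inter> T'"
    using assms mesh_face[OF assms(1,2)] interior_subset
    by (intro subset_of_face_of[of "T \<inter> T'" T]) auto
  then show ?thesis by simp
qed

text \<open>The gradient is constant in the interior of an element, so one chosen point carries it.\<close>

definition slope :: "(R3 \<Rightarrow> real) \<Rightarrow> R3 set \<Rightarrow> R3" where
  "slope v T = grad v (SOME x. x \<in> interior T)"

lemma affine_on_element:
  assumes T: "T \<in> \<T>" and v: "\<And>x. x \<in> T \<Longrightarrow> v x = a \<bullet> x + b"
  shows grad_affine: "x \<in> interior T \<Longrightarrow> grad v x = a" and slope_affine: "slope v T = a"
proof -
  show grad: "grad v x = a" if x: "x \<in> interior T" for x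
  proof (rule grad_eqI)
    have eq: "a \<bullet> x + b = v x" if "x \<in> interior T" for x
      using v that interior_subset by (metis subsetD)
    have "((\<lambda>x. a \<bullet> x + b) has_derivative (\<lambda>d. a \<bullet> d)) (at x)"
      by (auto intro!: derivative_eq_intros)
    then show "(v has_derivative (\<lambda>d. a \<bullet> d)) (at x)"
      by (rule has_derivative_transform_within_open[OF _ open_interior x eq])
  qed
  show "slope v T = a"
    unfolding slope_def by (rule grad, rule someI_ex) (use element_interior[OF T] in auto)
qed

lemma Vh_slope:
  assumes v: "v \<in> Vh D \<T>" and T: "T \<in> \<T>"
  shows Vh_grad_interior: "x \<in> interior T \<Longrightarrow> grad v x = slope v T"
    and Vh_difference: "x \<in> T \<Longrightarrow> y \<in> T \<Longrightarrow> v x - v y = slope v T \<bullet> (x - y)"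
proof -
  obtain a b where ab: "\<And>x. x \<in> T \<Longrightarrow> v x = a \<bullet> x + b"
    using v T by (auto simp: Vh_def)
  note affine = affine_on_element[where v=v, OF T ab]
  show "x \<in> interior T \<Longrightarrow> grad v x = slope v T"
    by (simp add: affine)
  show "x \<in> T \<Longrightarrow> y \<in> T \<Longrightarrow> v x - v y = slope v T \<bullet> (x - y)"
    by (simp add: ab affine(2) inner_diff_right)
qed

lemma Vh0_D: "v \<in> Vh0 D \<T> \<Longrightarrow> v \<in> Vh D \<T>"
  and Vh0_vanish: "v \<in> Vh0 D \<T> \<Longrightarrow> x \<notin> D \<Longrightarrow> v x = 0"
  using domain by (auto simp: Vh0_def is_domain_def frontier_def interior_open)

text \<open>The extension by zero is continuous because \<open>closure D\<close> and \<open>- D\<close> are closed, cover the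
space, and overlap in the frontier, where the function vanishes.\<close>

lemma Vh0_continuous:
  assumes v: "v \<in> Vh0 D \<T>" shows "continuous_on UNIV v"
proof -
  have "continuous_on (- D) v"
    using Vh0_vanish[OF v] by (subst continuous_on_cong[where g="\<lambda>_. 0"]) auto
  moreover have "continuous_on (closure D) v"
    using v by (simp add: Vh0_def Vh_def)
  moreover have "closed (- D)"
    using domain by (simp add: is_domain_def closed_Compl)
  ultimately have "continuous_on (closure D \<union> - D) v"
    by (intro continuous_on_closed_Un) auto
  moreover have "closure D \<union> - D = UNIV"
    using closure_subset by blast
  ultimately show ?thesis by simp
qed

lemma Vh0_piecewise_affine:
  assumes v: "v \<in> Vh0 D \<T>" shows "piecewise_affine \<T> v (slope v)"
proof
  show "v x = 0" if "x \<notin> \<Union>\<T>" for x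
    using that Vh0_vanish[OF v, of x] closure_subset[of D] by (auto simp: mesh_cover)
qed (use v Vh_difference[OF Vh0_D[OF v]] in
      \<open>auto intro: finite_mesh element_compact element_convex Vh0_continuous\<close>)

lemma Vh0_zero: "(\<lambda>_. 0) \<in> Vh0 D \<T>"
  unfolding Vh0_def Vh_def
  by (auto intro!: exI[of _ "0::R3"] exI[of _ "0::real"])

lemma Vh0_lincomb:
  assumes u: "u \<in> Vh0 D \<T>" and v: "v \<in> Vh0 D \<T>"
  shows "(\<lambda>x. u x + c * v x) \<in> Vh0 D \<T>"
    and "T \<in> \<T> \<Longrightarrow> slope (\<lambda>x. u x + c * v x) T = slope u T + c *\<^sub>R slope v T"
proof -
  have aff: "\<exists>b. \<forall>x\<in>T. u x + c * v x = (slope u T + c *\<^sub>R slope v T) \<bullet> x + b" if T: "T \<in> \<T>" for T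
  proof -
    obtain x0 where x0: "x0 \<in> T"
      using element_interior[OF T] interior_subset by blast
    have "u x + c * v x = (slope u T + c *\<^sub>R slope v T) \<bullet> x
        + (u x0 + c * v x0 - (slope u T + c *\<^sub>R slope v T) \<bullet> x0)" if x: "x \<in> T" for x
    proof -
      have eq: "u x = u x0 + slope u T \<bullet> (x - x0)" "v x = v x0 + slope v T \<bullet> (x - x0)"
        using Vh_difference[OF Vh0_D[OF u] T x x0] Vh_difference[OF Vh0_D[OF v] T x x0] by auto
      show ?thesis
        by (simp add: eq inner_add_left inner_diff_right algebra_simps)
    qed
    then show ?thesis by blast
  qed
  have "continuous_on (closure D) (\<lambda>x. u x + c * v x)"
    using u v by (auto simp: Vh0_def Vh_def intro!: continuous_intros)
  then show "(\<lambda>x. u x + c * v x) \<in> Vh0 D \<T>"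
    using u v aff unfolding Vh0_def Vh_def by fastforce
  show "slope (\<lambda>x. u x + c * v x) T = slope u T + c *\<^sub>R slope v T" if T: "T \<in> \<T>"
  proof -
    obtain b where b: "\<And>x. x \<in> T \<Longrightarrow> u x + c * v x = (slope u T + c *\<^sub>R slope v T) \<bullet> x + b"
      using aff[OF T] by blast
    show ?thesis by (rule slope_affine[OF T b])
  qed
qed

text \<open>The faces form a null set, and off them both gradients are constant on the element
containing the point, or zero outside the mesh. Convexity of \<open>\<Omega>\<close> ensures that element
interiors, which lie only in \<open>interior (closure \<Omega>)\<close> a priori, are contained in \<open>\<Omega>\<close>.\<close>

lemma inner_L2_grad_eq_sum:
  assumes u: "u \<in> Vh0 D \<T>" and v: "v \<in> Vh0 D \<T>"
    and Om: "open \<Omega>" "convex \<Omega>" "D \<subseteq> \<Omega>"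
  shows "inner_L2 \<Omega> (grad u) (grad v)
       = (\<Sum>T\<in>\<T>. measure lborel T * (slope u T \<bullet> slope v T))"
proof -
  define f where "f x = indicator \<Omega> x *\<^sub>R (grad u x \<bullet> grad v x)" for x
  define g where "g x = (\<Sum>T\<in>\<T>. indicator (interior T) x * (slope u T \<bullet> slope v T))" for x
  have g_int: "integrable lebesgue (\<lambda>x. indicator (interior T) x * (slope u T \<bullet> slope v T))"
    if "T \<in> \<T>" for T
  proof -
    have "interior T \<in> lmeasurable"
      using compact_imp_bounded[OF element_compact[OF that]] by (simp add: lmeasurable_interior)
    then show ?thesis
      by (intro integrable_mult_left integrable_real_indicator) (auto simp: fmeasurable_def)
  qed
  have interior_in: "interior T \<subseteq> \<Omega>" if "T \<in> \<T>" for T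
  proof -
    have "interior T \<subseteq> interior (closure \<Omega>)"
      using that mesh_cover closure_mono[OF Om(3)] by (intro interior_mono) auto
    then show ?thesis
      using Om by (simp add: convex_interior_closure interior_open)
  qed
  have "negligible (\<Union>T\<in>\<T>. frontier T)"
    using finite_mesh element_convex by (intro negligible_Union) (auto intro: negligible_convex_frontier)
  then have "AE x in lebesgue. x \<notin> (\<Union>T\<in>\<T>. frontier T)"
    unfolding negligible_iff_null_sets by (rule AE_not_in)
  then have ae: "AE x in lebesgue. g x = f x"
  proof (rule AE_mp, intro AE_I2 impI)
    fix x assume x: "x \<notin> (\<Union>T\<in>\<T>. frontier T)"
    show "g x = f x"
    proof (cases "x \<in> \<Union>\<T>")
      case True
      then obtain T where T: "T \<in> \<T>" "x \<in> T" by blast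
      then have xi: "x \<in> interior T"
        using x closure_subset by (auto simp: frontier_def)
      have other: "x \<notin> interior T'" if "T' \<in> \<T> - {T}" for T'
      proof
        assume "x \<in> interior T'"
        then have "T' = T"
          using element_subset_if_meets_interior[of T T' x] element_subset_if_meets_interior[of T' T x]
            that T xi interior_subset by blast
        then show False using that by simp
      qed
      have "g x = indicator (interior T) x * (slope u T \<bullet> slope v T)"
        unfolding g_def using other T finite_mesh
        by (subst sum.remove[OF finite_mesh T(1)]) (auto intro!: sum.neutral)
      also have "\<dots> = f x"
        using xi interior_in[OF T(1)] Vh_grad_interior[OF Vh0_D[OF u] T(1) xi]
          Vh_grad_interior[OF Vh0_D[OF v] T(1) xi]
        by (auto simp: f_def)
      finally show ?thesis .
    next
      case False
      then have xo: "x \<in> - closure D" by (simp add: mesh_cover)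
      have "(u has_derivative (\<lambda>d. 0 \<bullet> d)) (at x)"
      proof (rule has_derivative_transform_within_open[OF _ _ xo])
        show "((\<lambda>_. 0) has_derivative (\<lambda>d. 0 \<bullet> d)) (at x)" by simp
      qed (use u in \<open>auto simp: Vh0_def\<close>)
      then have "f x = 0" using grad_eqI[of u 0 x] by (simp add: f_def)
      moreover have "x \<notin> interior T" if "T \<in> \<T>" for T
        using False that interior_subset by blast
      then have "g x = 0" by (simp add: g_def)
      ultimately show ?thesis by simp
    qed
  qed
  have g_meas: "g \<in> borel_measurable lebesgue"
    unfolding g_def by (intro borel_measurable_sum borel_measurable_integrable g_int)
  have "inner_L2 \<Omega> (grad u) (grad v) = integral\<^sup>L lebesgue f"
    by (simp add: inner_L2_def set_lebesgue_integral_def f_def[abs_def])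
  also have "\<dots> = integral\<^sup>L lebesgue g"
    using ae borel_measurable_AE[OF g_meas ae] g_meas by (intro integral_cong_AE) auto
  also have "\<dots> = (\<Sum>T\<in>\<T>. measure lebesgue (interior T) * (slope u T \<bullet> slope v T))"
    unfolding g_def using g_int by (subst Bochner_Integration.integral_sum) auto
  also have "\<dots> = (\<Sum>T\<in>\<T>. measure lborel T * (slope u T \<bullet> slope v T))"
  proof (intro sum.cong refl)
    fix T assume T: "T \<in> \<T>"
    have "measure lebesgue (interior T) = measure lebesgue T"
      using element_compact[OF T] element_convex[OF T]
      by (intro measure_interior negligible_convex_frontier compact_imp_bounded)
    also have "\<dots> = measure lborel T"
      using element_compact[OF T] by (simp add: borel_closed compact_imp_closed)
    finally show "measure lebesgue (interior T) * (slope u T \<bullet> slope v T)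
        = measure lborel T * (slope u T \<bullet> slope v T)" by simp
  qed
  finally show ?thesis .
qed

text \<open>The zero set of an affine function is convex, so an element on whose vertices it vanishes
lies in it. This supplies the separating points for the representation of functionals.\<close>

lemma Vh0_eq_zero_if_vertices:
  obtains P where "finite P" "\<And>u. u \<in> Vh0 D \<T> \<Longrightarrow> (\<And>p. p \<in> P \<Longrightarrow> u p = 0) \<Longrightarrow> u = (\<lambda>_. 0)"
proof -
  have "\<exists>C. finite C \<and> T = convex hull C" if "T \<in> \<T>" for T
    using mesh_simplex[OF that] by (auto simp: simplex)
  then obtain V where V: "\<And>T. T \<in> \<T> \<Longrightarrow> finite (V T) \<and> T = convex hull (V T)"
    by metis
  have "u = (\<lambda>_. 0)" if u: "u \<in> Vh0 D \<T>" and zero: "\<And>p. p \<in> (\<Union>T\<in>\<T>. V T) \<Longrightarrow> u p = 0" for u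
  proof
    fix x
    show "u x = 0"
    proof (cases "x \<in> \<Union>\<T>")
      case False
      then show ?thesis using u by (simp add: Vh0_def mesh_cover)
    next
      case True
      then obtain T where T: "T \<in> \<T>" "x \<in> T" by blast
      obtain a b where ab: "\<And>x. x \<in> T \<Longrightarrow> u x = a \<bullet> x + b"
        using Vh0_D[OF u] T by (auto simp: Vh_def)
      have "V T \<subseteq> T" using V[OF T(1)] hull_subset by metis
      then have "V T \<subseteq> {x. a \<bullet> x = - b}"
        using ab zero T by fastforce
      then have "convex hull (V T) \<subseteq> {x. a \<bullet> x = - b}"
        by (intro hull_minimal convex_hyperplane)
      then show ?thesis using V[OF T(1)] T ab by fastforce
    qed
  qed
  then show thesis
    using that[of "\<Union>T\<in>\<T>. V T"] finite_mesh V by blast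
qed

text \<open>The discrete Sobolev inequality is used twice. It makes the Dirichlet form definite, so that the
discrete Green's function \<open>G\<close> exists and is unique. Applied to \<open>G\<close> at its own pole, where the
energy of \<open>G\<close> equals \<open>G z\<close>, it reads \<open>(G z)\<^sup>2 \<le> K * G z\<close>.\<close>

lemma discrete_green_diagonal_le:
  assumes Om: "open \<Omega>" "convex \<Omega>" "D \<subseteq> \<Omega>" and h: "0 < h" and c: "0 < c"
    and vol: "\<And>T. T \<in> \<T> \<Longrightarrow> c * h ^ 3 \<le> measure lborel T"
  shows "discrete_green \<Omega> D \<T> z z \<le> (6 / sqrt c + 12)\<^sup>2 / h"
proof -
  define W where "W = Vh0 D \<T>"
  define B where "B u v = inner_L2 \<Omega> (grad u) (grad v)" for u v
  define K where "K = (6 / sqrt c + 12)\<^sup>2 / h"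
  have B: "B u v = (\<Sum>T\<in>\<T>. measure lborel T * (slope u T \<bullet> slope v T))"
    if "u \<in> W" "v \<in> W" for u v
    using that inner_L2_grad_eq_sum[OF _ _ Om] by (simp add: B_def W_def)
  have bound: "(v x)\<^sup>2 \<le> K * B v v" if "v \<in> W" for v x
  proof -
    interpret piecewise_affine \<T> v "slope v"
      using that Vh0_piecewise_affine by (simp add: W_def)
    have "(v x)\<^sup>2 \<le> K * energy"
      unfolding K_def by (rule value_le_energy[OF _ h c vol]) auto
    then show ?thesis
      by (simp add: B[OF that that] energy_def power2_norm_eq_inner)
  qed
  have definite: "v = (\<lambda>_. 0)" if "v \<in> W" "B v v = 0" for v
    using bound[OF that(1)] that(2) by (simp add: fun_eq_iff)
  have closed: "(\<lambda>x. u x + c * v x) \<in> W" if "u \<in> W" "v \<in> W" for u v c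
    using that Vh0_lincomb by (simp add: W_def)
  have linear: "B (\<lambda>x. u x + c * v x) w = B u w + c * B v w"
    if "u \<in> W" "v \<in> W" "w \<in> W" for u v w c
    using that Vh0_lincomb(2)[of u v]
    by (simp add: B closed W_def[symmetric] inner_add_left algebra_simps sum.distrib sum_distrib_left)
  have sym: "B u v = B v u" for u v
    by (simp add: B_def inner_L2_def inner_commute)
  obtain P where P: "finite P" "\<And>u. u \<in> W \<Longrightarrow> (\<And>p. p \<in> P \<Longrightarrow> u p = 0) \<Longrightarrow> u = (\<lambda>_. 0)"
    using Vh0_eq_zero_if_vertices by (auto simp: W_def)
  have "\<exists>G\<in>W. \<forall>v\<in>W. B G v = v z"
    by (rule riesz_representation_finite_points[OF P(1) closed _ sym linear definite P(2)])
      (use Vh0_zero in \<open>auto simp: W_def\<close>)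
  then obtain G where G: "G \<in> W" "\<And>v. v \<in> W \<Longrightarrow> B G v = v z" by blast
  have "discrete_green \<Omega> D \<T> z = G"
    unfolding discrete_green_def W_def[symmetric] B_def[symmetric]
  proof (rule the_equality)
    fix G' assume G': "G' \<in> W \<and> (\<forall>v\<in>W. B G' v = v z)"
    define w where "w = (\<lambda>x. G' x + (-1) * G x)"
    have w: "w \<in> W" unfolding w_def using G' G(1) by (intro closed) auto
    have "B w w = B G' w + (-1) * B G w"
      using G' G(1) w by (subst w_def) (intro linear, auto)
    then have "B w w = 0" using G' G(2) w by simp
    then have "w = (\<lambda>_. 0)" using definite w by blast
    then show "G' = G" by (simp add: w_def fun_eq_iff)
  qed (use G in auto)
  moreover have "G z \<le> K"
  proof (cases "G z \<le> 0")
    case True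
    moreover have "0 \<le> K" using h by (simp add: K_def)
    ultimately show ?thesis by linarith
  next
    case False
    then show ?thesis
      using bound[OF G(1), of z] G by (simp add: power2_eq_square)
  qed
  ultimately show ?thesis by (simp add: K_def)
qed

end

section \<open>Volumes of the elements of a quasi-uniform mesh\<close>

lemma ball_in_element:
  assumes T: "T \<noteq> {}" and d: "0 < d" "d < inscribed_diameter T"
  obtains x r where "d / 2 < r" "cball x r \<subseteq> T"
proof -
  let ?S = "{2 * r | r. 0 \<le> r \<and> (\<exists>x. cball x r \<subseteq> T)}"
  have "\<exists>s\<in>?S. d < s"
  proof (rule less_cSupD)
    obtain x where "x \<in> T" using T by blast
    then have "cball x 0 \<subseteq> T" by simp
    then show "?S \<noteq> {}" by blast
    show "d < Sup ?S" using d by (simp add: inscribed_diameter_def)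
  qed
  then obtain r x where "d < 2 * r" "cball x r \<subseteq> T" by blast
  then show thesis using that[of r x] by simp
qed

text \<open>Quasi-uniformity bounds the diameter of an element from below by a multiple of \<open>h\<close>, and shape
regularity passes this on to an inscribed ball.\<close>

lemma uniform_element_volume:
  assumes "shape_regular \<T>" "quasi_uniform \<T>"
    and "\<And>h. h \<in> {0<..<1} \<Longrightarrow> tetrahedral_mesh (D h) (\<T> h)"
  obtains c where "0 < c" "\<And>h T. h \<in> {0<..<1} \<Longrightarrow> T \<in> \<T> h \<Longrightarrow> c * h ^ 3 \<le> measure lborel T"
proof -
  obtain \<sigma> where \<sigma>: "\<And>h T. h \<in> {0<..<1} \<Longrightarrow> T \<in> \<T> h \<Longrightarrow> diameter T \<le> \<sigma> * inscribed_diameter T"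
    using assms(1) unfolding shape_regular_def by metis
  obtain \<kappa> where \<kappa>: "0 < \<kappa>" "\<And>h T. h \<in> {0<..<1} \<Longrightarrow> T \<in> \<T> h \<Longrightarrow> \<kappa> * h \<le> diameter T"
    using assms(2) unfolding quasi_uniform_def by metis
  \<comment> \<open>using \<open>1 + \<bar>\<sigma>\<bar>\<close> avoids a case distinction on the sign of \<open>\<sigma>\<close>; one factor 2 passes from
    diameter to radius, the other leaves room below the supremum, which may not be attained\<close>
  define \<rho> where "\<rho> = \<kappa> / (4 * (1 + \<bar>\<sigma>\<bar>))"
  have \<rho>: "0 < \<rho>" using \<kappa> by (simp add: \<rho>_def add_pos_nonneg)
  define b where "b = measure lborel (ball (0::R3) 1)"
  have b: "0 < b" by (simp add: b_def content_ball_pos)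
  have "\<rho> ^ 3 * b * h ^ 3 \<le> measure lborel T" if h: "h \<in> {0<..<1}" and T: "T \<in> \<T> h" for h T
  proof -
    have s: "3 simplex T"
      using assms(3)[OF h] T by (simp add: tetrahedral_mesh_def)
    have cT: "compact T" using compact_simplex[OF s] .
    have ne: "T \<noteq> {}" using s by auto
    have "0 < \<kappa> * h" using \<kappa> h by simp
    also have dT: "\<kappa> * h \<le> \<sigma> * inscribed_diameter T"
      using \<kappa>(2)[OF h T] \<sigma>[OF h T] by simp
    finally have pos: "0 < \<sigma> * inscribed_diameter T" .
    have bdd: "bdd_above {2 * r | r. 0 \<le> r \<and> (\<exists>x. cball x r \<subseteq> T)}"
    proof (rule bdd_aboveI)
      fix s assume "s \<in> {2 * r | r. 0 \<le> r \<and> (\<exists>x. cball x r \<subseteq> T)}"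
      then obtain r x where r: "s = 2 * r" "0 \<le> r" "cball x r \<subseteq> T" by blast
      have "diameter (cball x r) \<le> diameter T"
        using r compact_imp_bounded[OF cT] by (intro diameter_subset)
      then show "s \<le> diameter T" using r by simp
    qed
    obtain x where x: "x \<in> T" using ne by blast
    have "cball x 0 \<subseteq> T" using x by simp
    then have "2 * 0 \<in> {2 * r | r. 0 \<le> r \<and> (\<exists>x. cball x r \<subseteq> T)}" by blast
    then have "0 \<le> inscribed_diameter T"
      unfolding inscribed_diameter_def using cSup_upper[OF _ bdd] by simp
    then have "\<sigma> * inscribed_diameter T \<le> (1 + \<bar>\<sigma>\<bar>) * inscribed_diameter T"
      by (intro mult_right_mono) auto
    then have "4 * \<rho> * h \<le> inscribed_diameter T"
      using dT by (simp add: \<rho>_def field_simps)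
    moreover have "0 < \<rho> * h" using \<rho> h by simp
    ultimately have "2 * \<rho> * h < inscribed_diameter T" by linarith
    moreover have "0 < 2 * \<rho> * h" using \<rho> h by simp
    ultimately obtain y r where "2 * \<rho> * h / 2 < r" and r: "cball y r \<subseteq> T"
      using ball_in_element[OF ne] by metis
    then have r': "\<rho> * h < r" by simp
    have "\<rho> ^ 3 * b * h ^ 3 = measure lborel (ball y (\<rho> * h))"
      using content_ball_conv_unit_ball[of "\<rho> * h" y] \<rho> h
      by (simp add: b_def power_mult_distrib)
    also have "\<dots> \<le> measure lborel T"
    proof (rule measure_mono_fmeasurable)
      show "ball y (\<rho> * h) \<subseteq> T" using r r' by (auto simp: subset_iff)
      show "T \<in> fmeasurable lborel"
        using emeasure_bounded_finite[OF compact_imp_bounded[OF cT]] compact_imp_closed[OF cT]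
        by (intro fmeasurableI) (auto simp: borel_closed)
    qed simp
    finally show ?thesis .
  qed
  then show thesis
    using that[of "\<rho> ^ 3 * b"] \<rho> b by simp
qed

section \<open>The bound on the diagonal\<close>

theorem lemma4p1:
  fixes \<Omega> :: "(real ^ 3) set"
    and \<Omega>h :: "real \<Rightarrow> (real ^ 3) set"
    and \<T> :: "real \<Rightarrow> (real ^ 3) set set"
    and k :: nat
  assumes "is_domain \<Omega>" and "convex \<Omega>" and "bounded \<Omega>"
    and "k \<ge> 1" and "Ck_boundary k \<Omega>"
    and "\<And>h. h \<in> {0<..<1} \<Longrightarrow> is_domain (\<Omega>h h)"
    and "\<And>h. h \<in> {0<..<1} \<Longrightarrow> \<Omega>h h \<subseteq> \<Omega>"
    and "\<And>h. h \<in> {0<..<1} \<Longrightarrow> tetrahedral_mesh (\<Omega>h h) (\<T> h)"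
    and "shape_regular \<T>" and "quasi_uniform \<T>"
  shows "\<exists>C::real. \<forall>h\<in>{0<..<1}. \<forall>z\<in>\<Omega>h h.
           discrete_green \<Omega> (\<Omega>h h) (\<T> h) z z \<le> C * inverse h"
proof -
  obtain c where c: "0 < c"
    "\<And>h T. h \<in> {0<..<1} \<Longrightarrow> T \<in> \<T> h \<Longrightarrow> c * h ^ 3 \<le> measure lborel T"
    using uniform_element_volume[OF assms(9,10,8)] by blast
  have "discrete_green \<Omega> (\<Omega>h h) (\<T> h) z z \<le> (6 / sqrt c + 12)\<^sup>2 * inverse h"
    if h: "h \<in> {0<..<1}" for h z
  proof -
    interpret meshed_domain "\<Omega>h h" "\<T> h"
      using assms(6,8)[OF h] by unfold_locales
    show ?thesis
      using discrete_green_diagonal_le[of \<Omega> h c z] assms(1,2) assms(7)[OF h] h c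
      by (simp add: is_domain_def divide_inverse)
  qed
  then show ?thesis by blast
qed

end
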